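(* Let $n\ge 3$, $p\ge 2$ and $m\ge 1$ be integers and let $X^0$ be an initial polygon with $n$ vertices in $\mathbb{R}^p$. Then the equation $$\frac{dX}{dt}=(-1)^{m+1}M^mX,\qquad X(0)=X^0,$$ has a unique solution $X(t)$, which exists for all time and converges exponentially to a point as $t\to\infty$: there are a point $q\in\mathbb{R}^p$ and constants $C,\delta>0$ such that $|X_j(t)-q|\le Ce^{-\delta t}$ for all $t\ge0$ and all $j=0,\dots,n-1$. Moreover, under appropriate rescaling the solution is asymptotic as $t\to\infty$ to a planar polygon with $n$ vertices in $\mathbb{R}^p$ which is the affine image of a regular polygon in $\mathbb{R}^2$: there exist $k\in\{1,\dots,\lfloor n/2\rfloor\}$ and an affine (possibly degenerate) map $T:\mathbb{R}^2\to\mathbb{R}^p$ such that for every $j=0,\dots,n-1$ $$\lim_{t\to\infty}e^{-\lambda_{m,k}t}\left(X_j(t)-q\right)=T\left(\cos\tfrac{2\pi kj}{n},\ \sin\tfrac{2\pi kj}{n}\right),$$ and $k$ can be chosen so that these limits are not all zero unless all vertices of $X^0$ coincide.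
   Context: A closed $n$-gon in $\mathbb{R}^p$ is an ordered tuple $X=(X_0,\dots,X_{n-1})^T$ of points $X_j\in\mathbb{R}^p$, regarded as a real $n\times p$ matrix with rows $X_j$; indices are taken modulo $n$. $M$ is the $n\times n$ circulant matrix with $-2$ on the diagonal, $1$ in positions $(j,j\pm1)$ (indices modulo $n$), and $0$ elsewhere, so $(MX)_j=X_{j+1}-2X_j+X_{j-1}$. $\lambda_{m,k}=(-1)^{m+1}\left(-4\sin^2(\pi k/n)\right)^m$ for $k=0,\dots,n-1$ are the eigenvalues of $(-1)^{m+1}M^m$. For $k=1,\dots,n-1$ the regular polygon $P_k$ in $\mathbb{R}^2$ is the polygon with $j$th vertex $(\cos\frac{2\pi kj}{n},\sin\frac{2\pi kj}{n})$, $j=0,\dots,n-1$ (convex or star-shaped, possibly multiply covered; for $n$ even $P_{n/2}$ is a multiply covered segment). *)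

theory Defs
  imports "Jordan_Normal_Form.Matrix" "HOL-Analysis.Analysis"
begin

text \<open>A closed n-gon in real p-space is a function \<open>X :: nat \<Rightarrow> real ^ 'p\<close> of which only the values
  \<open>X j\<close> with \<open>j < n\<close> matter, with \<open>p = CARD('p)\<close>; a time-dependent n-gon is a function
  \<open>X :: real \<Rightarrow> nat \<Rightarrow> real ^ 'p\<close>. Matrices of size \<open>n \<times> n\<close> are those of Jordan_Normal_Form,
  since their dimension is a natural number.\<close>

definition polygon_matrix :: "nat \<Rightarrow> real Matrix.mat" where
  "polygon_matrix n = Matrix.mat n n (\<lambda>(i, j).
     if i = j then - 2 else if j = (i + 1) mod n \<or> i = (j + 1) mod n then 1 else 0)"

text \<open>Row \<open>j\<close> of the product of \<open>A\<close> with the \<open>n \<times> p\<close> matrix whose rows are the vertices of \<open>X\<close>.\<close>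

definition mat_polygon :: "real Matrix.mat \<Rightarrow> (nat \<Rightarrow> real ^ 'p) \<Rightarrow> nat \<Rightarrow> real ^ 'p" where
  "mat_polygon A X j = (\<Sum>i<dim_col A. (A $$ (j, i)) *\<^sub>R X i)"

definition polyharmonic_solution ::
  "nat \<Rightarrow> nat \<Rightarrow> (nat \<Rightarrow> real ^ 'p) \<Rightarrow> real set \<Rightarrow> (real \<Rightarrow> nat \<Rightarrow> real ^ 'p) \<Rightarrow> bool" where
  "polyharmonic_solution n m X0 I X \<longleftrightarrow>
     (\<forall>j<n. X 0 j = X0 j) \<and>
     (\<forall>t\<in>I. \<forall>j<n. ((\<lambda>s. X s j) has_vector_derivative
        mat_polygon ((- 1) ^ (m + 1) \<cdot>\<^sub>m (polygon_matrix n ^\<^sub>m m)) (X t) j) (at t within I))"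

definition flow_eigenvalue :: "nat \<Rightarrow> nat \<Rightarrow> nat \<Rightarrow> real" where
  "flow_eigenvalue n m k = (- 1) ^ (m + 1) * (- 4 * (sin (pi * real k / real n))\<^sup>2) ^ m"

definition regular_polygon :: "nat \<Rightarrow> nat \<Rightarrow> nat \<Rightarrow> real ^ 2" where
  "regular_polygon n k j =
     vector [cos (2 * pi * real k * real j / real n), sin (2 * pi * real k * real j / real n)]"

definition affine_map :: "('a::real_vector \<Rightarrow> 'b::real_vector) \<Rightarrow> bool" where
  "affine_map T \<longleftrightarrow> (\<exists>L b. linear L \<and> (\<forall>x. T x = L x + b))"

end

theory Submission
  imports Defs
begin

text \<open>Discrete Fourier analysis diagonalises the flow: \<open>M\<close> acts on the component of a polygon at
  frequency \<open>k\<close> as multiplication by \<open>- 4 sin\<^sup>2 (\<pi> k / n)\<close>, so the solution is the sum of the components of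
  \<open>X\<^sup>0\<close>, each scaled by \<open>exp (\<lambda> t)\<close> with its own eigenvalue \<open>\<lambda>\<close>. The component at frequency \<open>0\<close> is the
  centroid, and all other eigenvalues are negative. Frequencies \<open>k\<close> and \<open>n - k\<close> share their eigenvalue
  and their component, and the eigenvalues strictly decrease on \<open>1, \<dots>, \<lfloor>n / 2\<rfloor>\<close>; hence the least
  frequency in this range with a nonzero component dominates. For uniqueness, each component of a
  difference of two solutions solves a scalar linear equation with zero initial value.\<close>

section \<open>Real Fourier components of a polygon\<close>

text \<open>The cosine kernel averages the complex Fourier projections at frequencies
  \<open>k\<close> and \<open>n - k\<close>, which keeps everything real. When these frequencies
  differ, their joint contribution is split into two equal halves; this is the source of the factor
  \<open>card {k, n - k}\<close> in the rescaled limit.\<close>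

definition fourier_component :: "nat \<Rightarrow> nat \<Rightarrow> (nat \<Rightarrow> 'a::real_vector) \<Rightarrow> nat \<Rightarrow> 'a" where
  "fourier_component n k X j =
     (1 / real n) *\<^sub>R (\<Sum>l<n. cos (2 * pi * real k * (real j - real l) / real n) *\<^sub>R X l)"

abbreviation flow_matrix :: "nat \<Rightarrow> nat \<Rightarrow> real Matrix.mat" where
  "flow_matrix n m \<equiv> (- 1) ^ (m + 1) \<cdot>\<^sub>m (polygon_matrix n ^\<^sub>m m)"

definition laplace_eigenvalue :: "nat \<Rightarrow> nat \<Rightarrow> real" where
  "laplace_eigenvalue n k = - 4 * (sin (pi * real k / real n))\<^sup>2"

lemma flow_eigenvalue_laplace:
  "flow_eigenvalue n m k = (- 1) ^ (m + 1) * laplace_eigenvalue n k ^ m"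
  by (simp add: flow_eigenvalue_def laplace_eigenvalue_def)

text \<open>The sign \<open>(- 1) ^ (m + 1)\<close> combines with the \<open>(- 1) ^ m\<close>
  hidden in the power to a single minus. Comparing eigenvalues thus becomes comparing powers of
  nonnegative numbers, whatever the parity of \<open>m\<close>.\<close>

lemma flow_eigenvalue_eq:
  "flow_eigenvalue n m k = - ((4 * (sin (pi * real k / real n))\<^sup>2) ^ m)"
proof -
  have "(- 4 * (sin (pi * real k / real n))\<^sup>2) ^ m
      = (- 1) ^ m * (4 * (sin (pi * real k / real n))\<^sup>2) ^ m"
    by (metis mult_minus1 mult_minus_left power_mult_distrib)
  moreover have "(- 1) ^ (m + 1) * ((- 1 :: real) ^ m) = - 1"
    by (cases "even m") auto
  ultimately show ?thesis
    unfolding flow_eigenvalue_def by (metis mult.assoc mult_minus1)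
qed

text \<open>The sum is the real part of a geometric sum over powers of an \<open>n\<close>-th root
  of unity, which vanishes unless that root is 1.\<close>

lemma sum_cos_roots_of_unity:
  assumes "j < n" "l < n"
  shows "(\<Sum>k<n. cos (2 * pi * real k * (real j - real l) / real n)) = (if j = l then real n else 0)"
proof (cases "j = l")
  case False
  define z where "z = cis (2 * pi * (real j - real l) / real n)"
  have n: "real n > 0" using assms by simp
  have pow: "z ^ k = cis (2 * pi * real k * (real j - real l) / real n)" for k
    by (simp add: z_def Complex.DeMoivre mult_ac)
  have angle: "2 * pi * real n * (real j - real l) / real n = 2 * pi * of_int (int j - int l)"
    using n by simp
  have zn: "z ^ n = 1"
    unfolding pow angle by (rule cis_multiple_2pi) simp
  have "z \<noteq> 1"
  proof
    assume "z = 1"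
    then have "cos (2 * pi * (real j - real l) / real n) = 1"
      by (metis z_def cis.sel(1) one_complex.sel(1))
    then obtain i :: int where "2 * pi * (real j - real l) / real n = of_int i * 2 * pi"
      using cos_one_2pi_int by blast
    then have "(2 * pi) * (real j - real l) = (2 * pi) * (of_int i * real n)"
      using n by (simp only: nonzero_divide_eq_eq mult_ac)
    then have "real j - real l = of_int i * real n"
      by simp
    then have "real_of_int (int j - int l) = real_of_int (i * int n)"
      by simp
    then have "int j - int l = i * int n"
      by linarith
    \<comment> \<open>If \<open>z\<close> were 1, then \<open>j - l\<close> would be a multiple of
      \<open>n\<close>; being smaller than \<open>n\<close> in absolute value, it would be
      0.\<close>
    moreover have "\<bar>int j - int l\<bar> < int n"
      using assms by linarith
    ultimately have "\<bar>i\<bar> * int n < 1 * int n"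
      by (simp add: abs_mult)
    then have "\<bar>i\<bar> < 1"
      by (rule mult_right_less_imp_less) simp
    then have "i = 0"
      by simp
    then show False
      using \<open>int j - int l = i * int n\<close> False by simp
  qed
  then have "(\<Sum>k<n. z ^ k) = 0"
    using zn by (simp add: geometric_sum)
  then have "(\<Sum>k<n. Re (z ^ k)) = 0"
    by (metis Re_sum zero_complex.sel(1))
  then show ?thesis
    using False by (simp add: pow)
qed simp

text \<open>Fourier inversion: after swapping the sums, orthogonality leaves only the term
  \<open>l = j\<close>.\<close>

lemma sum_fourier_component:
  assumes "j < n"
  shows "(\<Sum>k<n. fourier_component n k X j) = X j"
proof -
  have "(\<Sum>k<n. fourier_component n k X j)
      = (1 / real n) *\<^sub>R (\<Sum>l<n. (\<Sum>k<n. cos (2 * pi * real k * (real j - real l) / real n)) *\<^sub>R X l)"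
    unfolding fourier_component_def scaleR_sum_right[symmetric] scaleR_sum_left
    by (subst sum.swap) simp
  also have "\<dots> = (1 / real n) *\<^sub>R (\<Sum>l<n. if j = l then real n *\<^sub>R X l else 0)"
    using assms by (intro arg_cong2[of _ _ _ _ scaleR] sum.cong) (auto simp: sum_cos_roots_of_unity)
  also have "\<dots> = X j"
    using assms by (simp add: sum.delta)
  finally show ?thesis .
qed

text \<open>Since \<open>j - l\<close> is an integer, the reflection negates the angle up to a
  multiple of 2 pi, and cosine is even.\<close>

lemma cos_frequency_reflect:
  assumes "k \<le> n" "n > 0"
  shows "cos (2 * pi * real (n - k) * (real j - real l) / real n)
       = cos (2 * pi * real k * (real j - real l) / real n)"
proof -
  have "2 * pi * real (n - k) * (real j - real l) / real n
      = 2 * pi * real_of_int (int j - int l) - 2 * pi * real k * (real j - real l) / real n"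
    using assms by (simp add: field_simps of_nat_diff)
  moreover have "cos (2 * pi * real_of_int i - x) = cos x" for i x
    by (simp add: cos_diff)
  ultimately show ?thesis
    by (simp only:)
qed

lemma fourier_component_reflect:
  assumes "k \<le> n" "n > 0"
  shows "fourier_component n (n - k) X j = fourier_component n k X j"
  unfolding fourier_component_def by (simp add: cos_frequency_reflect[OF assms])

lemma fourier_component_0: "fourier_component n 0 X j = (1 / real n) *\<^sub>R (\<Sum>l<n. X l)"
  by (simp add: fourier_component_def)

lemma fourier_component_cong:
  assumes "\<And>l. l < n \<Longrightarrow> X l = Y l"
  shows "fourier_component n k X j = fourier_component n k Y j"
  using assms by (simp add: fourier_component_def)

lemma fourier_component_scaleR:
  "fourier_component n k (\<lambda>l. c *\<^sub>R X l) j = c *\<^sub>R fourier_component n k X j"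
  by (simp add: fourier_component_def scaleR_sum_right mult.left_commute mult.commute)

lemma has_vector_derivative_fourier_component:
  assumes "\<And>l. l < n \<Longrightarrow> ((\<lambda>s. X s l) has_vector_derivative X' l) (at t within I)"
  shows "((\<lambda>s. fourier_component n k (X s) j) has_vector_derivative fourier_component n k X' j)
           (at t within I)"
  unfolding fourier_component_def
  by (intro bounded_linear.has_vector_derivative[OF bounded_linear_scaleR_right]
      has_vector_derivative_sum assms) simp

section \<open>The second-difference matrix and its action on sampled cosines\<close>

lemma polygon_matrix_carrier [simp]: "polygon_matrix n \<in> carrier_mat n n"
  by (simp add: polygon_matrix_def)

lemma polygon_matrix_sym:
  "i < n \<Longrightarrow> j < n \<Longrightarrow> polygon_matrix n $$ (i, j) = polygon_matrix n $$ (j, i)"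
  by (auto simp: polygon_matrix_def)

lemma sum_polygon_matrix_row:
  fixes f :: "nat \<Rightarrow> real"
  assumes "n \<ge> 3" "j < n"
  shows "(\<Sum>i<n. polygon_matrix n $$ (j, i) * f i)
       = f ((j + 1) mod n) - 2 * f j + f ((j + n - 1) mod n)"
proof -
  \<comment> \<open>The cyclic predecessor is written with \<open>j + n - 1\<close>, because
    subtraction on naturals would truncate at \<open>j = 0\<close>.\<close>
  have pred: "j = (i + 1) mod n \<longleftrightarrow> i = (j + n - 1) mod n" if "i < n" for i
    using assms that by (auto simp: mod_if)
  \<comment> \<open>For \<open>n \<ge> 3\<close> the three positions are distinct, so the row splits
    into three indicator sums without overlap.\<close>
  have ne: "(j + 1) mod n \<noteq> j" "(j + n - 1) mod n \<noteq> j" "(j + 1) mod n \<noteq> (j + n - 1) mod n"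
    using assms by (auto simp: mod_if)
  have "(\<Sum>i<n. polygon_matrix n $$ (j, i) * f i)
      = (\<Sum>i<n. (if i = j then - 2 * f i else 0) + (if i = (j + 1) mod n then f i else 0)
          + (if i = (j + n - 1) mod n then f i else 0))"
  proof (rule sum.cong)
    fix i assume "i \<in> {..<n}"
    then show "polygon_matrix n $$ (j, i) * f i
      = (if i = j then - 2 * f i else 0) + (if i = (j + 1) mod n then f i else 0)
          + (if i = (j + n - 1) mod n then f i else 0)"
      using assms ne pred[of i] by (auto simp: polygon_matrix_def)
  qed simp
  also have "\<dots> = f ((j + 1) mod n) - 2 * f j + f ((j + n - 1) mod n)"
    using assms by (simp add: sum.distrib sum.delta)
  finally show ?thesis .
qed

text \<open>With step angle \<open>\<theta>\<close>, the addition formulas turn the second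
  difference of a cosine into the factor 2 cos \<theta> - 2, which is -4 times the squared sine of
  the half angle. Wrapping around is harmless because \<open>n * \<theta>\<close> is a multiple of 2
  pi.\<close>

lemma sum_polygon_matrix_cos:
  assumes "n \<ge> 3" "j < n"
  shows "(\<Sum>i<n. polygon_matrix n $$ (j, i) * cos (2 * pi * real k * (real i - real l) / real n))
       = laplace_eigenvalue n k * cos (2 * pi * real k * (real j - real l) / real n)"
proof -
  define \<theta> where "\<theta> = 2 * pi * real k / real n"
  have n: "real n > 0" using assms by simp
  have period: "cos (\<theta> * (real (a mod n) - real l)) = cos (\<theta> * (real a - real l))" for a
  proof -
    have "real a = real (a mod n) + real n * real (a div n)"
      by (metis mod_mult_div_eq of_nat_add of_nat_mult)
    then have "\<theta> * (real a - real l)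
        = \<theta> * (real (a mod n) - real l) + 2 * pi * real_of_int (int (k * (a div n)))"
      using n by (simp add: \<theta>_def field_simps)
    moreover have "cos (x + 2 * pi * real_of_int i) = cos x" for x i
      by (simp add: cos_add)
    ultimately show ?thesis
      by (simp only:)
  qed
  define x where "x = \<theta> * (real j - real l)"
  have next_vertex: "cos (\<theta> * (real ((j + 1) mod n) - real l)) = cos (x + \<theta>)"
    unfolding period x_def by (simp add: algebra_simps)
  have "\<theta> * (real (j + n - 1) - real l) = x - \<theta> + 2 * pi * real_of_int (int k)"
    using assms n by (simp add: \<theta>_def x_def field_simps of_nat_diff)
  moreover have "cos (y + 2 * pi * real_of_int i) = cos y" for y i
    by (simp add: cos_add)
  ultimately have prev_vertex: "cos (\<theta> * (real ((j + n - 1) mod n) - real l)) = cos (x - \<theta>)"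
    unfolding period by metis
  have cos_\<theta>: "cos \<theta> = 1 - 2 * (sin (pi * real k / real n))\<^sup>2"
    using cos_double_sin[of "pi * real k / real n"] by (simp add: \<theta>_def mult.assoc)
  have "cos (x + \<theta>) - 2 * cos x + cos (x - \<theta>) = laplace_eigenvalue n k * cos x"
    unfolding cos_add cos_diff laplace_eigenvalue_def cos_\<theta> by (simp add: algebra_simps)
  then have "(\<Sum>i<n. polygon_matrix n $$ (j, i) * cos (\<theta> * (real i - real l)))
       = laplace_eigenvalue n k * cos x"
    using sum_polygon_matrix_row[OF assms, of "\<lambda>i. cos (\<theta> * (real i - real l))"]
      next_vertex prev_vertex by (simp add: x_def)
  then show ?thesis
    by (simp add: \<theta>_def x_def)
qed

section \<open>Matrices acting on polygons, and the spectrum of the flow\<close>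

lemma mat_polygon_cong:
  assumes "A \<in> carrier_mat n n" "\<And>i. i < n \<Longrightarrow> X i = Y i"
  shows "mat_polygon A X j = mat_polygon A Y j"
  using assms by (auto simp: mat_polygon_def)

lemma mat_polygon_scaleR: "mat_polygon A (\<lambda>i. c *\<^sub>R X i) j = c *\<^sub>R mat_polygon A X j"
  by (simp add: mat_polygon_def scaleR_sum_right mult.commute)

lemma mat_polygon_sum: "mat_polygon A (\<lambda>i. \<Sum>k\<in>K. X k i) j = (\<Sum>k\<in>K. mat_polygon A (X k) j)"
  unfolding mat_polygon_def scaleR_sum_right by (rule sum.swap)

lemma mat_polygon_smult:
  assumes "A \<in> carrier_mat n n" "j < n"
  shows "mat_polygon (c \<cdot>\<^sub>m A) X j = c *\<^sub>R mat_polygon A X j"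
  using assms by (simp add: mat_polygon_def scaleR_sum_right)

lemma mat_polygon_one:
  assumes "j < n"
  shows "mat_polygon (1\<^sub>m n) X j = X j"
proof -
  have "mat_polygon (1\<^sub>m n) X j = (\<Sum>i<n. if j = i then X i else 0)"
    using assms unfolding mat_polygon_def by (intro sum.cong) auto
  then show ?thesis
    using assms by (simp add: sum.delta)
qed

lemma mat_polygon_mult:
  assumes "A \<in> carrier_mat n n" "B \<in> carrier_mat n n" "j < n"
  shows "mat_polygon (A * B) X j = mat_polygon A (mat_polygon B X) j"
proof -
  have "mat_polygon (A * B) X j = (\<Sum>i<n. \<Sum>l<n. (A $$ (j, l) * B $$ (l, i)) *\<^sub>R X i)"
    using assms
    by (simp add: mat_polygon_def scalar_prod_def scaleR_sum_left lessThan_atLeast0)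
  also have "\<dots> = (\<Sum>l<n. \<Sum>i<n. (A $$ (j, l) * B $$ (l, i)) *\<^sub>R X i)"
    by (rule sum.swap)
  also have "\<dots> = mat_polygon A (mat_polygon B X) j"
    using assms by (simp add: mat_polygon_def scaleR_sum_right)
  finally show ?thesis .
qed

lemma mat_polygon_pow_Suc:
  assumes "A \<in> carrier_mat n n" "j < n"
  shows "mat_polygon (A ^\<^sub>m Suc m) X j = mat_polygon (A ^\<^sub>m m) (mat_polygon A X) j"
  using assms by (simp add: mat_polygon_mult[OF pow_carrier_mat])

lemma mat_polygon_pow_eigen:
  assumes A: "A \<in> carrier_mat n n" and eigen: "\<And>j. j < n \<Longrightarrow> mat_polygon A X j = \<mu> *\<^sub>R X j"
    and j: "j < n"
  shows "mat_polygon (A ^\<^sub>m m) X j = \<mu> ^ m *\<^sub>R X j"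
  using j
proof (induction m arbitrary: j)
  case 0
  then show ?case
    using A by (simp add: mat_polygon_one)
next
  case (Suc m)
  have "mat_polygon (A ^\<^sub>m Suc m) X j = mat_polygon (A ^\<^sub>m m) (mat_polygon A X) j"
    using A Suc.prems by (rule mat_polygon_pow_Suc)
  also have "\<dots> = mat_polygon (A ^\<^sub>m m) (\<lambda>i. \<mu> *\<^sub>R X i) j"
    by (rule mat_polygon_cong[OF pow_carrier_mat[OF A]]) (rule eigen)
  also have "\<dots> = \<mu> ^ Suc m *\<^sub>R X j"
    using Suc by (simp add: mat_polygon_scaleR)
  finally show ?case .
qed

text \<open>As a function of the vertex, a component is a combination of shifted cosines with
  coefficients \<open>X l\<close>, and each shifted cosine is an eigenvector.\<close>

lemma polygon_matrix_fourier_component: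
  assumes "n \<ge> 3" "j < n"
  shows "mat_polygon (polygon_matrix n) (fourier_component n k X) j
       = laplace_eigenvalue n k *\<^sub>R fourier_component n k X j"
proof -
  let ?c = "\<lambda>i l. cos (2 * pi * real k * (real i - real l) / real n)"
  have "mat_polygon (polygon_matrix n) (fourier_component n k X) j
      = (1 / real n) *\<^sub>R (\<Sum>i<n. \<Sum>l<n. (polygon_matrix n $$ (j, i) * ?c i l) *\<^sub>R X l)"
    by (simp add: mat_polygon_def fourier_component_def scaleR_sum_right polygon_matrix_def
        mult.left_commute mult.commute)
  also have "\<dots> = (1 / real n) *\<^sub>R (\<Sum>l<n. (\<Sum>i<n. polygon_matrix n $$ (j, i) * ?c i l) *\<^sub>R X l)"
    unfolding scaleR_sum_left by (subst sum.swap) simp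
  also have "\<dots> = laplace_eigenvalue n k *\<^sub>R fourier_component n k X j"
    unfolding sum_polygon_matrix_cos[OF assms]
    by (simp add: fourier_component_def scaleR_sum_right mult.left_commute mult.commute)
  finally show ?thesis .
qed

text \<open>Here the matrix acts before the projection, on an arbitrary polygon. Symmetry of both
  the matrix and the kernel lets the matrix be moved onto the kernel. Uniqueness rests on this form,
  existence on the previous one.\<close>

lemma fourier_component_polygon_matrix:
  assumes "n \<ge> 3"
  shows "fourier_component n k (mat_polygon (polygon_matrix n) X) j
       = laplace_eigenvalue n k *\<^sub>R fourier_component n k X j"
proof -
  let ?c = "\<lambda>i l. cos (2 * pi * real k * (real i - real l) / real n)"
  have c_sym: "?c i l = ?c l i" for i l
    by (metis cos_minus minus_diff_eq minus_divide_left mult_minus_right)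
  have "fourier_component n k (mat_polygon (polygon_matrix n) X) j
      = (1 / real n) *\<^sub>R (\<Sum>l<n. \<Sum>i<n. (?c j l * polygon_matrix n $$ (l, i)) *\<^sub>R X i)"
    by (simp add: mat_polygon_def fourier_component_def scaleR_sum_right polygon_matrix_def)
  also have "\<dots> = (1 / real n) *\<^sub>R (\<Sum>i<n. (\<Sum>l<n. ?c j l * polygon_matrix n $$ (l, i)) *\<^sub>R X i)"
    unfolding scaleR_sum_left by (subst sum.swap) simp
  also have "\<dots> = (1 / real n) *\<^sub>R (\<Sum>i<n. (\<Sum>l<n. polygon_matrix n $$ (i, l) * ?c l j) *\<^sub>R X i)"
    by (intro arg_cong2[of _ _ _ _ scaleR] sum.cong refl)
      (metis (no_types, lifting) c_sym lessThan_iff mult.commute polygon_matrix_sym)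
  also have "\<dots> = (1 / real n) *\<^sub>R (\<Sum>i<n. (laplace_eigenvalue n k * ?c i j) *\<^sub>R X i)"
    using sum_polygon_matrix_cos[OF assms] by simp
  also have "\<dots> = laplace_eigenvalue n k *\<^sub>R fourier_component n k X j"
    unfolding c_sym[of _ j]
    by (simp add: fourier_component_def scaleR_sum_right mult.left_commute mult.commute)
  finally show ?thesis .
qed

lemma flow_matrix_fourier_component:
  assumes "n \<ge> 3" "j < n"
  shows "mat_polygon (flow_matrix n m) (fourier_component n k X) j
       = flow_eigenvalue n m k *\<^sub>R fourier_component n k X j"
proof -
  have "mat_polygon (polygon_matrix n ^\<^sub>m m) (fourier_component n k X) j
      = laplace_eigenvalue n k ^ m *\<^sub>R fourier_component n k X j"
    using assms
    by (intro mat_polygon_pow_eigen[OF polygon_matrix_carrier] polygon_matrix_fourier_component)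
  then show ?thesis
    by (simp only: flow_eigenvalue_laplace scaleR_scaleR[symmetric]
        mat_polygon_smult[OF pow_carrier_mat[OF polygon_matrix_carrier] assms(2)])
qed

lemma fourier_component_flow_matrix:
  assumes "n \<ge> 3"
  shows "fourier_component n k (mat_polygon (flow_matrix n m) X) j
       = flow_eigenvalue n m k *\<^sub>R fourier_component n k X j"
proof -
  have pow: "fourier_component n k (mat_polygon (polygon_matrix n ^\<^sub>m m) X) j
      = laplace_eigenvalue n k ^ m *\<^sub>R fourier_component n k X j"
  proof (induction m arbitrary: X)
    case 0
    have "fourier_component n k (mat_polygon (1\<^sub>m n) X) j = fourier_component n k X j"
      by (rule fourier_component_cong) (rule mat_polygon_one)
    moreover have "dim_row (polygon_matrix n) = n"
      by (simp add: polygon_matrix_def)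
    ultimately show ?case
      by simp
  next
    case (Suc m)
    have "fourier_component n k (mat_polygon (polygon_matrix n ^\<^sub>m Suc m) X) j
        = fourier_component n k
            (mat_polygon (polygon_matrix n ^\<^sub>m m) (mat_polygon (polygon_matrix n) X)) j"
      by (rule fourier_component_cong) (rule mat_polygon_pow_Suc[OF polygon_matrix_carrier])
    then show ?case
      by (simp only: Suc fourier_component_polygon_matrix[OF assms] scaleR_scaleR power_Suc2)
  qed
  have "fourier_component n k (mat_polygon (flow_matrix n m) X) j
      = fourier_component n k
          (\<lambda>l. (- 1) ^ (m + 1) *\<^sub>R mat_polygon (polygon_matrix n ^\<^sub>m m) X l) j"
    by (rule fourier_component_cong)
      (rule mat_polygon_smult[OF pow_carrier_mat[OF polygon_matrix_carrier]])
  then show ?thesis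
    by (simp only: fourier_component_scaleR pow flow_eigenvalue_laplace scaleR_scaleR)
qed

section \<open>Existence and uniqueness of the solution\<close>

definition fourier_solution ::
  "nat \<Rightarrow> nat \<Rightarrow> (nat \<Rightarrow> 'a::real_vector) \<Rightarrow> real \<Rightarrow> nat \<Rightarrow> 'a" where
  "fourier_solution n m X0 t j =
     (\<Sum>k<n. exp (flow_eigenvalue n m k * t) *\<^sub>R fourier_component n k X0 j)"

lemma polyharmonic_solution_fourier:
  assumes "n \<ge> 3"
  shows "polyharmonic_solution n m X0 UNIV (fourier_solution n m X0)"
  unfolding polyharmonic_solution_def
proof (intro conjI allI impI ballI)
  fix j assume "j < n"
  then show "fourier_solution n m X0 0 j = X0 j"
    by (simp add: fourier_solution_def sum_fourier_component)
next
  fix t :: real and j assume "j < n"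
  have "mat_polygon (flow_matrix n m) (fourier_solution n m X0 t) j
      = (\<Sum>k<n. exp (flow_eigenvalue n m k * t) *\<^sub>R
           (flow_eigenvalue n m k *\<^sub>R fourier_component n k X0 j))"
    unfolding fourier_solution_def mat_polygon_sum mat_polygon_scaleR
    by (simp only: flow_matrix_fourier_component[OF assms \<open>j < n\<close>])
  moreover have "((\<lambda>s. fourier_solution n m X0 s j) has_vector_derivative
      (\<Sum>k<n. exp (flow_eigenvalue n m k * t) *\<^sub>R
           (flow_eigenvalue n m k *\<^sub>R fourier_component n k X0 j))) (at t)"
    unfolding fourier_solution_def
    by (auto intro!: derivative_eq_intros has_vector_derivative_sum simp: mult.commute)
  ultimately show "((\<lambda>s. fourier_solution n m X0 s j) has_vector_derivative
      mat_polygon (flow_matrix n m) (fourier_solution n m X0 t) j) (at t)"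
    by simp
qed

text \<open>The integrating factor \<open>exp (- c * s)\<close> makes the derivative of the product
  vanish, so the product is constant on the interval, with the value 0 it has at time 0.\<close>

lemma linear_ode_zero:
  fixes F :: "real \<Rightarrow> 'a::real_normed_vector"
  assumes I: "is_interval I" "0 \<in> I" "t \<in> I" and "F 0 = 0"
    and deriv: "\<And>s. s \<in> I \<Longrightarrow> (F has_vector_derivative c *\<^sub>R F s) (at s within I)"
  shows "F t = 0"
proof -
  have "((\<lambda>s. exp (- c * s) *\<^sub>R F s) has_vector_derivative 0) (at s within I)" if "s \<in> I" for s
    by (rule derivative_eq_intros deriv[OF that] refl | simp add: that)+
  then obtain d where d: "\<And>s. s \<in> I \<Longrightarrow> exp (- c * s) *\<^sub>R F s = d"
    using has_vector_derivative_zero_constant[of I] I(1) is_interval_convex by blast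
  then have "d = 0"
    using d[OF I(2)] \<open>F 0 = 0\<close> by simp
  then show ?thesis
    using d[OF I(3)] by simp
qed

text \<open>This decouples the system: each component of any solution satisfies its own equation
  with a scalar coefficient.\<close>

lemma polyharmonic_solution_fourier_component:
  assumes "n \<ge> 3" "polyharmonic_solution n m X0 I Y" "t \<in> I"
  shows "((\<lambda>s. fourier_component n k (Y s) j) has_vector_derivative
           flow_eigenvalue n m k *\<^sub>R fourier_component n k (Y t) j) (at t within I)"
  unfolding fourier_component_flow_matrix[OF assms(1), symmetric]
  using assms(2,3) by (intro has_vector_derivative_fourier_component)
    (auto simp: polyharmonic_solution_def)

lemma polyharmonic_solution_unique:
  assumes n: "n \<ge> 3" and I: "is_interval I" "0 \<in> I"
    and X: "polyharmonic_solution n m X0 I X" and Y: "polyharmonic_solution n m X0 I Y"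
    and "t \<in> I" "j < n"
  shows "Y t j = X t j"
proof -
  have "fourier_component n k (Y t) j - fourier_component n k (X t) j = 0" for k
  proof (rule linear_ode_zero[OF I \<open>t \<in> I\<close>])
    have "fourier_component n k (Y 0) j = fourier_component n k (X 0) j"
      using X Y by (intro fourier_component_cong) (simp add: polyharmonic_solution_def)
    then show "fourier_component n k (Y 0) j - fourier_component n k (X 0) j = 0"
      by simp
  next
    fix s assume "s \<in> I"
    then show "((\<lambda>s. fourier_component n k (Y s) j - fourier_component n k (X s) j)
        has_vector_derivative flow_eigenvalue n m k *\<^sub>R
          (fourier_component n k (Y s) j - fourier_component n k (X s) j)) (at s within I)"
      unfolding scaleR_diff_right
      by (intro has_vector_derivative_diff polyharmonic_solution_fourier_component[OF n X]
          polyharmonic_solution_fourier_component[OF n Y])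
  qed
  then have "(\<Sum>k<n. fourier_component n k (Y t) j) = (\<Sum>k<n. fourier_component n k (X t) j)"
    by simp
  then show ?thesis
    using \<open>j < n\<close> by (simp add: sum_fourier_component)
qed

section \<open>Ordering of the eigenvalues\<close>

text \<open>The condition on \<open>l\<close> says that it lies strictly between \<open>k\<close>
  and its mirror image. Sine increases on the first quarter turn; an \<open>l\<close> beyond the
  middle is reflected to \<open>n - l\<close>, which still exceeds \<open>k\<close>.\<close>

lemma sin_frequency_less:
  assumes "k < l" "l < n - k"
  shows "sin (pi * real k / real n) < sin (pi * real l / real n)"
proof -
  have half: "sin (pi * real k / real n) < sin (pi * real i / real n)" if "k < i" "2 * i \<le> n" for i
  proof -
    have n: "real n > 0" using that by simp
    have "pi * real i / real n \<le> pi / 2"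
      using that n by (simp add: field_simps flip: of_nat_mult)
    moreover have "pi * real k / real n < pi * real i / real n"
      using that n by (simp add: divide_strict_right_mono)
    moreover have "0 \<le> pi * real k / real n"
      by simp
    ultimately show ?thesis
      using pi_gt_zero by (intro sin_monotone_2pi) linarith+
  qed
  show ?thesis
  proof (cases "2 * l \<le> n")
    case False
    have "pi * real (n - l) / real n = pi - pi * real l / real n"
      using assms by (simp add: field_simps of_nat_diff)
    then have "sin (pi * real (n - l) / real n) = sin (pi * real l / real n)"
      by simp
    then show ?thesis
      using half[of "n - l"] assms False by simp
  qed (use half assms in simp)
qed

lemma sin_frequency_nonneg:
  assumes "k \<le> n"
  shows "0 \<le> sin (pi * real k / real n)"
proof (cases "n = 0")
  case False
  then have "pi * real k / real n \<le> pi"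
    using assms by (simp add: field_simps)
  then show ?thesis
    by (intro sin_ge_zero) auto
qed simp

lemma flow_eigenvalue_strict_decreasing:
  assumes "m \<ge> 1" "k < l" "l < n - k"
  shows "flow_eigenvalue n m l < flow_eigenvalue n m k"
proof -
  have "(sin (pi * real k / real n))\<^sup>2 < (sin (pi * real l / real n))\<^sup>2"
    using assms sin_frequency_less[of k l n] sin_frequency_nonneg[of k n]
    by (intro power_strict_mono) auto
  then have "(4 * (sin (pi * real k / real n))\<^sup>2) ^ m < (4 * (sin (pi * real l / real n))\<^sup>2) ^ m"
    using assms by (intro power_strict_mono) auto
  then show ?thesis
    by (simp add: flow_eigenvalue_eq)
qed

lemma flow_eigenvalue_0: "m \<ge> 1 \<Longrightarrow> flow_eigenvalue n m 0 = 0"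
  by (simp add: flow_eigenvalue_eq)

lemma flow_eigenvalue_reflect:
  assumes "k \<le> n" "n > 0"
  shows "flow_eigenvalue n m (n - k) = flow_eigenvalue n m k"
proof -
  have "pi * real (n - k) / real n = pi - pi * real k / real n"
    using assms by (simp add: field_simps of_nat_diff)
  then show ?thesis
    by (simp add: flow_eigenvalue_eq)
qed

section \<open>Convergence to the centroid and the rescaled limit\<close>

lemma fourier_solution_minus_centroid:
  assumes "m \<ge> 1" "n > 0"
  shows "fourier_solution n m X t j - (1 / real n) *\<^sub>R (\<Sum>l<n. X l)
       = (\<Sum>k\<in>{1..<n}. exp (flow_eigenvalue n m k * t) *\<^sub>R fourier_component n k X j)"
proof -
  have "{..<n} = insert 0 {1..<n}"
    using assms by auto
  then show ?thesis
    unfolding fourier_solution_def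
    by (simp add: fourier_component_0 flow_eigenvalue_0[OF assms(1)])
qed

lemma fourier_solution_convergence:
  fixes X :: "nat \<Rightarrow> 'a::real_normed_vector"
  assumes "m \<ge> 1" "n \<ge> 2"
  shows "\<exists>C \<delta> :: real. C > 0 \<and> \<delta> > 0 \<and> (\<forall>t\<ge>0. \<forall>j<n.
    norm (fourier_solution n m X t j - (1 / real n) *\<^sub>R (\<Sum>l<n. X l)) \<le> C * exp (- \<delta> * t))"
proof (intro exI conjI allI impI)
  let ?a = "\<lambda>j. \<Sum>k\<in>{1..<n}. norm (fourier_component n k X j)"
  \<comment> \<open>Summing over all vertices makes the constant uniform in \<open>j\<close>; the 1
    keeps it positive when all nonconstant components vanish. The rate below is the spectral gap,
    attained at frequencies 1 and \<open>n - 1\<close>.\<close>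
  let ?C = "1 + (\<Sum>j<n. ?a j)"
  let ?\<delta> = "- flow_eigenvalue n m 1"
  have a: "?a j \<ge> 0" for j
    by (rule sum_nonneg) simp
  show "?C > 0"
    using sum_nonneg[of "{..<n}" ?a] a by auto
  show "?\<delta> > 0"
    using flow_eigenvalue_strict_decreasing[OF assms(1), of 0 1 n] flow_eigenvalue_0[of m n] assms
    by simp
  fix t :: real and j assume "t \<ge> 0" "j < n"
  have le: "flow_eigenvalue n m k \<le> flow_eigenvalue n m 1" if "k \<in> {1..<n}" for k
  proof (cases "k = 1 \<or> k = n - 1")
    case True
    then show ?thesis
      using flow_eigenvalue_reflect[of 1 n m] assms by auto
  next
    case False
    then show ?thesis
      using that flow_eigenvalue_strict_decreasing[OF assms(1), of 1 k n] by force
  qed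
  have "norm (fourier_solution n m X t j - (1 / real n) *\<^sub>R (\<Sum>l<n. X l))
      \<le> (\<Sum>k\<in>{1..<n}. exp (flow_eigenvalue n m k * t) * norm (fourier_component n k X j))"
    using assms by (subst fourier_solution_minus_centroid) (auto intro!: norm_sum[THEN order_trans])
  also have "\<dots> \<le> (\<Sum>k\<in>{1..<n}. exp (- ?\<delta> * t) * norm (fourier_component n k X j))"
    using le \<open>t \<ge> 0\<close> by (intro sum_mono mult_right_mono) (auto intro: mult_right_mono)
  also have "\<dots> = ?a j * exp (- ?\<delta> * t)"
    by (simp add: sum_distrib_left mult.commute)
  also have "\<dots> \<le> ?C * exp (- ?\<delta> * t)"
  proof (rule mult_right_mono)
    have "?a j \<le> (\<Sum>j<n. ?a j)"
      using a \<open>j < n\<close> by (intro member_le_sum) auto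
    then show "?a j \<le> ?C" by simp
  qed simp
  finally show "norm (fourier_solution n m X t j - (1 / real n) *\<^sub>R (\<Sum>l<n. X l))
      \<le> ?C * exp (- ?\<delta> * t)" .
qed

text \<open>After rescaling, the modes \<open>k\<close> and \<open>n - k\<close> are constant in
  time, those strictly between decay, and those outside vanish by hypothesis and reflection. The set
  \<open>{k, n - k}\<close> counts the surviving modes: one if \<open>2 * k = n\<close>, otherwise
  two.\<close>

lemma fourier_solution_rescaled_limit:
  fixes X :: "nat \<Rightarrow> 'a::real_normed_vector"
  assumes "m \<ge> 1" and k: "1 \<le> k" "2 * k \<le> n"
    and zero: "\<And>i. 1 \<le> i \<Longrightarrow> i < k \<Longrightarrow> fourier_component n i X j = 0"
  shows "((\<lambda>t. exp (- flow_eigenvalue n m k * t) *\<^sub>R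
            (fourier_solution n m X t j - (1 / real n) *\<^sub>R (\<Sum>l<n. X l)))
          \<longlongrightarrow> real (card {k, n - k}) *\<^sub>R fourier_component n k X j) at_top"
proof -
  let ?r = "\<lambda>i. if i \<in> {k, n - k} then fourier_component n k X j else 0"
  have n: "n > 0" using k by simp
  have exp_diff_mult: "exp (- a * t) * exp (b * t) = exp ((b - a) * t)" for a b t :: real
    by (simp add: algebra_simps flip: exp_add)
  have "((\<lambda>t. exp ((flow_eigenvalue n m i - flow_eigenvalue n m k) * t) *\<^sub>R
      fourier_component n i X j) \<longlongrightarrow> ?r i) at_top" if i: "i \<in> {1..<n}" for i
  proof -
    consider "i \<in> {k, n - k}" | "i < k" | "n - k < i" | "k < i" "i < n - k"
      by force
    then show ?thesis
    proof cases
      case 1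
      then have "flow_eigenvalue n m i = flow_eigenvalue n m k"
        "fourier_component n i X j = fourier_component n k X j"
        using k n flow_eigenvalue_reflect[of k n] fourier_component_reflect[of k n] by auto
      then show ?thesis
        using 1 by simp
    next
      case 2
      then show ?thesis
        using i k zero[of i] by auto
    next
      case 3
      then have "fourier_component n i X j = 0"
        using i k n zero[of "n - i"] fourier_component_reflect[of i n X j] by simp
      then show ?thesis
        using 3 k by auto
    next
      case 4
      then have neg: "flow_eigenvalue n m i - flow_eigenvalue n m k < 0"
        using flow_eigenvalue_strict_decreasing[OF assms(1)] by simp
      have "((\<lambda>t. exp ((flow_eigenvalue n m i - flow_eigenvalue n m k) * t)) \<longlongrightarrow> 0) at_top"
        using neg
        by (intro filterlim_compose[OF exp_at_bot] filterlim_tendsto_neg_mult_at_bot[OF tendsto_const]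
            filterlim_ident)
      from tendsto_scaleR[OF this tendsto_const] show ?thesis
        using 4 by simp
    qed
  qed
  then have "((\<lambda>t. \<Sum>i\<in>{1..<n}. exp ((flow_eigenvalue n m i - flow_eigenvalue n m k) * t) *\<^sub>R
      fourier_component n i X j) \<longlongrightarrow> (\<Sum>i\<in>{1..<n}. ?r i)) at_top"
    by (rule tendsto_sum)
  moreover have "(\<Sum>i\<in>{1..<n}. ?r i) = real (card {k, n - k}) *\<^sub>R fourier_component n k X j"
  proof -
    have "(\<Sum>i\<in>{1..<n}. ?r i) = (\<Sum>i\<in>{k, n - k}. fourier_component n k X j)"
      using k by (intro sum.mono_neutral_cong_right) auto
    then show ?thesis
      by (simp add: sum_constant_scaleR)
  qed
  moreover have "exp (- flow_eigenvalue n m k * t) *\<^sub>R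
        (fourier_solution n m X t j - (1 / real n) *\<^sub>R (\<Sum>l<n. X l))
      = (\<Sum>i\<in>{1..<n}. exp ((flow_eigenvalue n m i - flow_eigenvalue n m k) * t) *\<^sub>R
          fourier_component n i X j)" for t
    unfolding fourier_solution_minus_centroid[OF assms(1) n]
    unfolding scaleR_sum_right scaleR_scaleR exp_diff_mult ..
  ultimately show ?thesis
    by (simp only:)
qed

section \<open>Affine images of regular polygons and the dominant frequency\<close>

text \<open>The addition formula for the cosine of a difference separates \<open>j\<close> from
  \<open>l\<close>, so the component depends linearly on the vertex of the regular polygon. The
  scalar \<open>c\<close> makes room for the number of surviving modes.\<close>

lemma fourier_component_affine_image:
  fixes X :: "nat \<Rightarrow> 'a::real_vector"
  obtains T :: "real ^ 2 \<Rightarrow> 'a"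
  where "affine_map T" "\<And>j. T (regular_polygon n k j) = c *\<^sub>R fourier_component n k X j"
proof
  let ?x = "\<lambda>l. 2 * pi * real k * real l / real n"
  let ?T = "\<lambda>x :: real ^ 2. (c / real n) *\<^sub>R
    (\<Sum>l<n. (vec_nth x 1 * cos (?x l) + vec_nth x 2 * sin (?x l)) *\<^sub>R X l)"
  have "linear ?T"
    by (rule linearI)
      (simp_all add: scaleR_sum_right sum.distrib[symmetric] algebra_simps)
  then show "affine_map ?T"
    unfolding affine_map_def by (intro exI[of _ ?T] exI[of _ 0]) simp
  fix j
  have "cos (2 * pi * real k * (real j - real l) / real n)
      = cos (?x j) * cos (?x l) + sin (?x j) * sin (?x l)" for l
    unfolding cos_diff[symmetric] by (simp add: algebra_simps diff_divide_distrib)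
  then show "?T (regular_polygon n k j) = c *\<^sub>R fourier_component n k X j"
    by (simp add: regular_polygon_def fourier_component_def)
qed

text \<open>Reflection extends the vanishing to all nonzero frequencies below \<open>n\<close>;
  inversion then leaves only frequency 0, the centroid.\<close>

lemma eq_centroid_if_fourier_components_zero:
  assumes "j < n" "\<And>k. 1 \<le> k \<Longrightarrow> 2 * k \<le> n \<Longrightarrow> fourier_component n k X j = 0"
  shows "X j = (1 / real n) *\<^sub>R (\<Sum>l<n. X l)"
proof -
  have "fourier_component n k X j = 0" if "k \<in> {1..<n}" for k
    using that assms(2)[of k] assms(2)[of "n - k"] fourier_component_reflect[of k n X j]
    by (cases "2 * k \<le> n") auto
  moreover have "{..<n} = insert 0 {1..<n}"
    using assms(1) by auto
  ultimately have "(\<Sum>k<n. fourier_component n k X j) = (1 / real n) *\<^sub>R (\<Sum>l<n. X l)"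
    by (simp add: fourier_component_0)
  then show ?thesis
    using assms(1) by (simp add: sum_fourier_component)
qed

lemma dominant_frequency:
  assumes "n \<ge> 2"
  obtains k where "1 \<le> k" "2 * k \<le> n"
    "\<And>i j. 1 \<le> i \<Longrightarrow> i < k \<Longrightarrow> j < n \<Longrightarrow> fourier_component n i X j = 0"
    "(\<exists>j<n. fourier_component n k X j \<noteq> 0) \<or> (\<forall>i<n. \<forall>j<n. X i = X j)"
proof (cases "\<exists>k. 1 \<le> k \<and> 2 * k \<le> n \<and> (\<exists>j<n. fourier_component n k X j \<noteq> 0)")
  case True
  define k where "k = (LEAST k. 1 \<le> k \<and> 2 * k \<le> n \<and> (\<exists>j<n. fourier_component n k X j \<noteq> 0))"
  have k: "1 \<le> k \<and> 2 * k \<le> n \<and> (\<exists>j<n. fourier_component n k X j \<noteq> 0)"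
    unfolding k_def using True by (rule LeastI_ex)
  have "fourier_component n i X j = 0" if "1 \<le> i" "i < k" "j < n" for i j
    using that k not_less_Least[OF that(2)[unfolded k_def]] by auto
  then show ?thesis
    using that k by blast
next
  case False
  then have "X j = (1 / real n) *\<^sub>R (\<Sum>l<n. X l)" if "j < n" for j
    using that by (intro eq_centroid_if_fourier_components_zero) auto
  then have const: "\<forall>i<n. \<forall>j<n. X i = X j"
    by metis
  \<comment> \<open>With no nonzero component any admissible frequency would do; choosing 1 makes
    the condition on smaller frequencies vacuous.\<close>
  show ?thesis
    by (rule that[of 1]) (use assms in simp, use assms in simp, simp, rule disjI2[OF const])
qed

theorem theorem5p4:
  fixes n m :: nat and X0 :: "nat \<Rightarrow> real ^ 'p"
  assumes "n \<ge> 3" and "CARD('p) \<ge> 2" and "m \<ge> 1"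
  shows "\<exists>X :: real \<Rightarrow> nat \<Rightarrow> real ^ 'p.
    polyharmonic_solution n m X0 UNIV X \<and>
    (\<forall>I Y. is_interval I \<and> 0 \<in> I \<and> polyharmonic_solution n m X0 I Y \<longrightarrow>
       (\<forall>t\<in>I. \<forall>j<n. Y t j = X t j)) \<and>
    (\<exists>q :: real ^ 'p.
       (\<exists>C \<delta> :: real. C > 0 \<and> \<delta> > 0 \<and>
          (\<forall>t\<ge>0. \<forall>j<n. norm (X t j - q) \<le> C * exp (- \<delta> * t))) \<and>
       (\<exists>k\<in>{1..n div 2}. \<exists>T :: real ^ 2 \<Rightarrow> real ^ 'p.
          affine_map T \<and>
          (\<forall>j<n. ((\<lambda>t. exp (- flow_eigenvalue n m k * t) *\<^sub>R (X t j - q))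
                    \<longlongrightarrow> T (regular_polygon n k j)) at_top) \<and>
          ((\<exists>j<n. T (regular_polygon n k j) \<noteq> 0) \<or> (\<forall>i<n. \<forall>j<n. X0 i = X0 j))))"
proof -
  let ?X = "fourier_solution n m X0"
  let ?q = "(1 / real n) *\<^sub>R (\<Sum>l<n. X0 l)"
  have n: "n \<ge> 2" using assms(1) by simp
  obtain k where k: "1 \<le> k" "2 * k \<le> n"
    and zero: "\<And>i j. 1 \<le> i \<Longrightarrow> i < k \<Longrightarrow> j < n \<Longrightarrow> fourier_component n i X0 j = 0"
    and nonzero: "(\<exists>j<n. fourier_component n k X0 j \<noteq> 0) \<or> (\<forall>i<n. \<forall>j<n. X0 i = X0 j)"
    using dominant_frequency[OF n, of X0] by metis
  obtain T :: "real ^ 2 \<Rightarrow> real ^ 'p" where T: "affine_map T"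
    "\<And>j. T (regular_polygon n k j) = real (card {k, n - k}) *\<^sub>R fourier_component n k X0 j"
    using fourier_component_affine_image[of n k "real (card {k, n - k})" X0] by metis
  have solution: "polyharmonic_solution n m X0 UNIV ?X"
    using assms(1) by (rule polyharmonic_solution_fourier)
  have unique: "Y t j = ?X t j"
    if "is_interval I" "0 \<in> I" "polyharmonic_solution n m X0 I Y" "t \<in> I" "j < n" for I Y t j
  \<comment> \<open>The global solution is restricted to \<open>I\<close>, so that both solutions
    live on the same interval.\<close>
  proof (rule polyharmonic_solution_unique[OF assms(1) that(1,2) _ that(3-5)])
    show "polyharmonic_solution n m X0 I ?X"
      using solution unfolding polyharmonic_solution_def
      by (auto intro: has_vector_derivative_at_within)
  qed
  have limit: "((\<lambda>t. exp (- flow_eigenvalue n m k * t) *\<^sub>R (?X t j - ?q))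
      \<longlongrightarrow> T (regular_polygon n k j)) at_top" if "j < n" for j
    unfolding T(2) using fourier_solution_rescaled_limit[OF assms(3) k] zero that by blast
  \<comment> \<open>The factor relating \<open>T\<close> to the component is nonzero, so a nonzero
    component gives a nonzero limit.\<close>
  have "card {k, n - k} \<noteq> 0"
    by simp
  then have "(\<exists>j<n. T (regular_polygon n k j) \<noteq> 0) \<or> (\<forall>i<n. \<forall>j<n. X0 i = X0 j)"
    using nonzero by (simp only: T(2) scaleR_eq_0_iff of_nat_eq_0_iff simp_thms)
  moreover have "k \<in> {1..n div 2}"
    using k by auto
  ultimately show ?thesis
    using solution unique fourier_solution_convergence[OF assms(3) n, of X0] T(1) limit
    by (intro exI[of _ ?X] conjI exI[of _ ?q] bexI[of _ k] exI[of _ T]) blast+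
qed

end
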